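(* Let $G$ be a connected graph of order $n$, minimum degree $\delta \geq 2$ and power domination number $\gamma_p = \gamma_p(G) \geq 2$. Then \[ rad_p(G) \leq \begin{cases} n - 5 & \text{if } \gamma_p = 2 \text{ and } \delta = 2,\\ n - \delta - 2 & \text{if } \gamma_p = 2 \text{ and } \delta > 2,\\ n - \gamma_p - \max\{2\gamma_p,\ \gamma_p + \delta\} + 1 & \text{if } \gamma_p > 2. \end{cases} \]
   Context: All graphs are finite, simple, undirected and non-empty. For a graph $G$ and $S \subseteq V(G)$, define $P^1_G(S) = N[S]$ (the closed neighbourhood of $S$), and for $i \geq 1$ let $V^i = \{v \in P^i_G(S) : |N[v] \setminus P^i_G(S)| \leq 1\}$ and $P^{i+1}_G(S) = P^i_G(S) \cup N[V^i]$. The set $S$ is a power dominating set (PDS) of $G$ if $P^i_G(S) = V(G)$ for some $i \ge 1$. The power domination number $\gamma_p(G)$ is the minimum cardinality of a PDS of $G$. For a PDS $S$, $rad_p(G,S) = \min\{i \geq 1 : P^i_G(S) = V(G)\}$. The propagation radius of $G$ is $rad_p(G) = \min\{rad_p(G,S) : S \text{ is a PDS of } G \text{ with } |S| = \gamma_p(G)\}$. *)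

theory Defs
  imports "Graph_Theory.Digraph_Component"
begin

text \<open>
  Finite simple undirected graphs are the \<^locale>\<open>pair_graph\<close>s of Graph_Theory: finite, loop-free,
  symmetric digraphs whose arcs are pairs of vertices, an edge being a pair of opposite arcs.
\<close>

definition closed_nbhd :: "'a pair_pre_digraph \<Rightarrow> 'a \<Rightarrow> 'a set" where
  "closed_nbhd G v = insert v {w. (v, w) \<in> parcs G}"

definition closed_nbhd_set :: "'a pair_pre_digraph \<Rightarrow> 'a set \<Rightarrow> 'a set" where
  "closed_nbhd_set G S = (\<Union>v\<in>S. closed_nbhd G v)"

text \<open>In a symmetric digraph the out-degree of a vertex is its degree as a vertex of the graph.\<close>

definition min_degree :: "'a pair_pre_digraph \<Rightarrow> nat" where
  "min_degree G = Min (out_degree (with_proj G) ` pverts G)"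

definition propagating :: "'a pair_pre_digraph \<Rightarrow> 'a set \<Rightarrow> 'a set" where
  "propagating G X = {v \<in> X. card (closed_nbhd G v - X) \<le> 1}"

text \<open>
  The set $P^i_G(S)$, which is meaningful for $i \geq 1$ only; the value at $0$ is a dummy that
  none of the definitions below uses.
\<close>

fun monitored :: "'a pair_pre_digraph \<Rightarrow> 'a set \<Rightarrow> nat \<Rightarrow> 'a set" where
  "monitored G S 0 = S"
| "monitored G S (Suc 0) = closed_nbhd_set G S"
| "monitored G S (Suc (Suc i)) =
     monitored G S (Suc i) \<union> closed_nbhd_set G (propagating G (monitored G S (Suc i)))"

definition power_dominating :: "'a pair_pre_digraph \<Rightarrow> 'a set \<Rightarrow> bool" where
  "power_dominating G S \<longleftrightarrow> S \<subseteq> pverts G \<and> (\<exists>i\<ge>1. monitored G S i = pverts G)"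

text \<open>
  The minima below range over nonempty sets of naturals whenever \<open>G\<close> is a \<^locale>\<open>pair_graph\<close>,
  since the whole vertex set is power dominating.
\<close>

definition power_domination_number :: "'a pair_pre_digraph \<Rightarrow> nat" where
  "power_domination_number G = (LEAST k. \<exists>S. power_dominating G S \<and> card S = k)"

definition radius_of :: "'a pair_pre_digraph \<Rightarrow> 'a set \<Rightarrow> nat" where
  "radius_of G S = (LEAST i. i \<ge> 1 \<and> monitored G S i = pverts G)"

definition propagation_radius :: "'a pair_pre_digraph \<Rightarrow> nat" where
  "propagation_radius G =
     (LEAST r. \<exists>S. power_dominating G S \<and> card S = power_domination_number G \<and> radius_of G S = r)"

end

theory Submission
  imports Defs
begin

text \<open>
  Every round of the process monitors a new vertex, so that a power dominating set \<open>S\<close> finishes within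
  \<open>n + 1 - |N[S]|\<close> rounds, and it suffices to find a minimum power dominating set with a large
  closed neighbourhood. If the number of non-isolated vertices of \<open>G[S]\<close> is maximal among these sets, then every
  vertex of \<open>S\<close> has two external private neighbours, whence \<open>|N[S]| \<ge> 3\<gamma>\<close> and
  \<open>|N[S]| \<ge> 2\<gamma> + \<delta> - 1\<close>. If the second bound is attained, then \<open>S\<close> is a clique, each of its
  vertices has exactly two private neighbours, and all other neighbours are common to all of \<open>S\<close>. For
  \<open>\<gamma> \<ge> 3\<close>, minimality then forbids edges between private neighbours of different vertices, so that
  exchanging one vertex of \<open>S\<close> for one of its private neighbours enlarges \<open>N[S]\<close>.
\<close>

section \<open>Private neighbours and the sets closed under propagation\<close>

definition epn :: "'a pair_pre_digraph \<Rightarrow> 'a set \<Rightarrow> 'a \<Rightarrow> 'a set" where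
  "epn G S v = {w \<in> closed_nbhd G v - S. \<forall>u\<in>S. w \<in> closed_nbhd G u \<longrightarrow> u = v}"

text \<open>These are the sets that propagation cannot enlarge. They replace the counting of rounds:
  a set of vertices is power dominating exactly when every such set containing its closed
  neighbourhood contains V(G).\<close>

definition forcing_closed :: "'a pair_pre_digraph \<Rightarrow> 'a set \<Rightarrow> bool" where
  "forcing_closed G X \<longleftrightarrow> (\<forall>v\<in>X. card (closed_nbhd G v - X) \<le> 1 \<longrightarrow> closed_nbhd G v \<subseteq> X)"

text \<open>The vertex \<open>y\<close> may or may not lie in \<open>X\<close>; one only has to name
  the single neighbour about which nothing is known.\<close>

lemma forcing_closedD:
  assumes "forcing_closed G X" "v \<in> X" "closed_nbhd G v \<subseteq> insert y X"
  shows "closed_nbhd G v \<subseteq> X"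
proof -
  have "closed_nbhd G v - X \<subseteq> {y}" using assms(3) by auto
  then have "card (closed_nbhd G v - X) \<le> card {y}" by (intro card_mono) auto
  then show ?thesis using assms(1,2) by (auto simp: forcing_closed_def)
qed

lemma closed_nbhd_self [simp]: "v \<in> closed_nbhd G v"
  by (simp add: closed_nbhd_def)

lemma closed_nbhd_subset_set: "v \<in> S \<Longrightarrow> closed_nbhd G v \<subseteq> closed_nbhd_set G S"
  by (auto simp: closed_nbhd_set_def)

lemma subset_closed_nbhd_set: "S \<subseteq> closed_nbhd_set G S"
  using closed_nbhd_subset_set by fastforce

lemma epn_subset: "epn G S v \<subseteq> closed_nbhd G v"
  by (auto simp: epn_def)

lemma monitored_mono_Suc: "i \<ge> 1 \<Longrightarrow> monitored G S i \<subseteq> monitored G S (Suc i)"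
  by (cases i) auto

lemma closed_nbhd_set_subset_monitored: "i \<ge> 1 \<Longrightarrow> closed_nbhd_set G S \<subseteq> monitored G S i"
  by (induction i rule: dec_induct) (use monitored_mono_Suc in fastforce)+

lemma forcing_closed_monitored:
  assumes "i \<ge> 1" "monitored G S (Suc i) = monitored G S i"
  shows "forcing_closed G (monitored G S i)"
  using assms by (cases i) (auto simp: forcing_closed_def propagating_def closed_nbhd_set_def)

section \<open>Growth of the monitored sets and the radius\<close>

context pair_graph
begin

lemma closed_nbhd_subset: "v \<in> pverts G \<Longrightarrow> closed_nbhd G v \<subseteq> pverts G"
  using in_arcsD2 by (auto simp: closed_nbhd_def)

lemma closed_nbhd_set_subset: "S \<subseteq> pverts G \<Longrightarrow> closed_nbhd_set G S \<subseteq> pverts G"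
  using closed_nbhd_subset by (fastforce simp: closed_nbhd_set_def)

lemma closed_nbhd_sym: "w \<in> closed_nbhd G v \<longleftrightarrow> v \<in> closed_nbhd G w"
  using arcs_symmetric by (auto simp: closed_nbhd_def)

lemma finite_closed_nbhd [simp]: "finite (closed_nbhd G v)"
proof -
  have "{w. (v, w) \<in> parcs G} \<subseteq> pverts G" using in_arcsD2 by auto
  then show ?thesis by (auto simp: closed_nbhd_def intro: finite_subset[OF _ pair_finite_verts])
qed

lemma finite_epn [simp]: "finite (epn G S v)"
  using epn_subset by (rule finite_subset) simp

lemma min_degree_less_card_closed_nbhd:
  assumes "v \<in> pverts G"
  shows "Suc (min_degree G) \<le> card (closed_nbhd G v)"
proof -
  have "out_arcs (with_proj G) v = Pair v ` (closed_nbhd G v - {v})"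
    using pair_no_loops by (fastforce simp: out_arcs_def closed_nbhd_def)
  then have "out_degree (with_proj G) v = card (closed_nbhd G v - {v})"
    by (simp add: out_degree_def card_image inj_on_def)
  moreover have "min_degree G \<le> out_degree (with_proj G) v"
    unfolding min_degree_def using assms by (intro Min_le) auto
  moreover have "card (closed_nbhd G v) = Suc (card (closed_nbhd G v - {v}))"
    by (rule card.remove) simp_all
  ultimately show ?thesis by linarith
qed

text \<open>Enlarging the monitored set to \<open>X\<close> leaves a propagating vertex with no more
  unmonitored neighbours, so it still propagates from \<open>X\<close>, and closedness of
  \<open>X\<close> keeps what it adds inside.\<close>

lemma monitored_subset_forcing_closed:
  assumes "closed_nbhd_set G S \<subseteq> X" "forcing_closed G X" "i \<ge> 1"
  shows "monitored G S i \<subseteq> X"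
  using assms(3)
proof (induction i rule: dec_induct)
  case base
  then show ?case using assms(1) by simp
next
  case (step i)
  then obtain k where i: "i = Suc k" by (cases i) auto
  have "closed_nbhd G v \<subseteq> X" if "v \<in> propagating G (monitored G S i)" for v
  proof -
    from that have v: "v \<in> X" "card (closed_nbhd G v - monitored G S i) \<le> 1"
      using step.IH by (auto simp: propagating_def)
    have "card (closed_nbhd G v - X) \<le> card (closed_nbhd G v - monitored G S i)"
      using step.IH by (intro card_mono) auto
    then show ?thesis using v assms(2) by (auto simp: forcing_closed_def)
  qed
  then show ?case using step.IH i by (auto simp: closed_nbhd_set_def)
qed

lemma monitored_subset:
  assumes "S \<subseteq> pverts G" "i \<ge> 1"
  shows "monitored G S i \<subseteq> pverts G"
  using assms closed_nbhd_subset closed_nbhd_set_subset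
  by (intro monitored_subset_forcing_closed) (auto simp: forcing_closed_def)

text \<open>Every round before the first forcing-closed stage adds at least one vertex. Round 1
  already is N[S], so only i - 1 additions are counted; hence the 1 on the right.\<close>

lemma card_monitored_ge:
  assumes "S \<subseteq> pverts G" "\<And>j. 1 \<le> j \<Longrightarrow> j < i \<Longrightarrow> \<not> forcing_closed G (monitored G S j)" "i \<ge> 1"
  shows "card (closed_nbhd_set G S) + i \<le> card (monitored G S i) + 1"
  using assms(3,2)
proof (induction i rule: dec_induct)
  case base
  then show ?case by simp
next
  case (step i)
  have "monitored G S i \<subset> monitored G S (Suc i)"
    using monitored_mono_Suc[of i G S] forcing_closed_monitored[of i G S] step.prems[of i] step.hyps
    by auto
  then have "card (monitored G S i) < card (monitored G S (Suc i))"
    using monitored_subset[OF assms(1), of "Suc i"]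
    by (intro psubset_card_mono) (auto intro: finite_subset[OF _ pair_finite_verts])
  then show ?case using step by simp
qed

lemma power_dominating_iff_forcing_closed:
  "power_dominating G S \<longleftrightarrow> S \<subseteq> pverts G \<and>
     (\<forall>X. closed_nbhd_set G S \<subseteq> X \<longrightarrow> forcing_closed G X \<longrightarrow> pverts G \<subseteq> X)"
  (is "_ \<longleftrightarrow> _ \<and> ?C")
proof (intro iffI conjI)
  assume "power_dominating G S"
  then show "S \<subseteq> pverts G" ?C
    using monitored_subset_forcing_closed by (auto simp: power_dominating_def) blast
next
  assume S: "S \<subseteq> pverts G \<and> ?C"
  have "\<exists>i\<ge>1. forcing_closed G (monitored G S i)"
  proof (rule ccontr)
    assume "\<not> ?thesis"
    \<comment> \<open>So many rounds of strict growth would need at least |V(G)| + 1 vertices, even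
      without counting N[S].\<close>
    then have "card (closed_nbhd_set G S) + (card (pverts G) + 2)
        \<le> card (monitored G S (card (pverts G) + 2)) + 1"
      using S by (intro card_monitored_ge) auto
    moreover have "card (monitored G S (card (pverts G) + 2)) \<le> card (pverts G)"
      using S by (intro card_mono monitored_subset) auto
    ultimately show False by simp
  qed
  then obtain i where i: "i \<ge> 1" "forcing_closed G (monitored G S i)" by blast
  then have "monitored G S i = pverts G"
    using S monitored_subset[of S i] closed_nbhd_set_subset_monitored[of i G S] by auto
  then show "power_dominating G S" using S i by (auto simp: power_dominating_def)
qed

text \<open>A closed set containing N[T] then contains N[S], hence everything. Every exchange below
  is checked this way: \<open>T\<close> need only force N[S].\<close>

lemma power_dominating_transfer:
  assumes "power_dominating G S" "T \<subseteq> pverts G"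
    and "\<And>X. closed_nbhd_set G T \<subseteq> X \<Longrightarrow> forcing_closed G X \<Longrightarrow> closed_nbhd_set G S \<subseteq> X"
  shows "power_dominating G T"
  using assms by (auto simp: power_dominating_iff_forcing_closed)

lemma power_domination_number_le: "power_dominating G S \<Longrightarrow> power_domination_number G \<le> card S"
  unfolding power_domination_number_def by (rule Least_le) auto

lemma propagation_radius_le:
  assumes "power_dominating G S" "card S = power_domination_number G"
  shows "propagation_radius G + card (closed_nbhd_set G S) \<le> card (pverts G) + 1"
proof -
  let ?r = "radius_of G S"
  have S: "S \<subseteq> pverts G" using assms by (simp add: power_dominating_def)
  have "\<exists>i. i \<ge> 1 \<and> monitored G S i = pverts G"
    using assms by (auto simp: power_dominating_def)
  then have r: "?r \<ge> 1 \<and> monitored G S ?r = pverts G"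
    unfolding radius_of_def by (rule LeastI_ex)
  \<comment> \<open>A closed stage contains N[S] and so equals V(G), against the minimality of the
    radius.\<close>
  have "\<not> forcing_closed G (monitored G S j)" if "1 \<le> j" "j < ?r" for j
  proof
    assume "forcing_closed G (monitored G S j)"
    then have "monitored G S j = pverts G"
      using assms(1) monitored_subset[OF S that(1)] closed_nbhd_set_subset_monitored[OF that(1), of G S]
      by (auto simp: power_dominating_iff_forcing_closed)
    then show False using that not_less_Least unfolding radius_of_def by blast
  qed
  then have "card (closed_nbhd_set G S) + ?r \<le> card (monitored G S ?r) + 1"
    using r S by (intro card_monitored_ge) auto
  moreover have "propagation_radius G \<le> ?r"
    unfolding propagation_radius_def using assms by (intro Least_le) auto
  ultimately show ?thesis using r by simp
qed

section \<open>Minimum sets whose vertices have two private neighbours\<close>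

definition non_isolated :: "'a set \<Rightarrow> 'a set" where
  "non_isolated S = {a \<in> S. \<exists>b\<in>S. b \<noteq> a \<and> b \<in> closed_nbhd G a}"

lemma obtain_private_set:
  assumes "min_degree G \<ge> 2"
  obtains S where "power_dominating G S" "card S = power_domination_number G"
    "\<And>v. v \<in> S \<Longrightarrow> card (epn G S v) \<ge> 2"
proof -
  let ?Q = "\<lambda>S. power_dominating G S \<and> card S = power_domination_number G"
  have "power_dominating G (pverts G)"
    using subset_closed_nbhd_set by (fastforce simp: power_dominating_iff_forcing_closed)
  then have "\<exists>k S. power_dominating G S \<and> card S = k" by blast
  then have "\<exists>S. ?Q S" unfolding power_domination_number_def by (rule LeastI_ex)
  \<comment> \<open>The uniform bound makes a maximum of \<open>card (non_isolated S)\<close>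
    exist.\<close>
  moreover have "card (non_isolated S) < Suc (card (pverts G))" if "?Q S" for S
    using that by (auto simp: power_dominating_def non_isolated_def intro!: card_mono le_imp_less_Suc)
  ultimately have "\<exists>S. ?Q S \<and> (\<forall>T. ?Q T \<longrightarrow> card (non_isolated T) \<le> card (non_isolated S))"
    by (metis ex_has_greatest_nat[of ?Q _ "\<lambda>S. card (non_isolated S)"])
  then obtain S where S: "?Q S"
    and max: "\<And>T. ?Q T \<Longrightarrow> card (non_isolated T) \<le> card (non_isolated S)"
    by blast
  have SV: "S \<subseteq> pverts G" and fin: "finite S"
    using S by (auto simp: power_dominating_def intro: finite_subset)
  have "card (epn G S v) \<ge> 2" if v: "v \<in> S" for v
  proof (rule ccontr)
    assume "\<not> card (epn G S v) \<ge> 2"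
    then have e1: "card (epn G S v) \<le> 1" by simp
    obtain x where x: "epn G S v \<subseteq> {x}"
      using e1 by (auto simp: le_Suc_eq card_1_singleton_iff)
    have transfer: "power_dominating G T"
      if T: "T \<subseteq> pverts G" "S - {v} \<subseteq> T" "v \<in> closed_nbhd_set G T" for T
    proof (rule power_dominating_transfer)
      fix X assume X: "closed_nbhd_set G T \<subseteq> X" "forcing_closed G X"
      have other: "closed_nbhd G u \<subseteq> X" if "u \<in> S" "u \<noteq> v" for u
        using that T(2) X(1) closed_nbhd_subset_set[of u T G] by auto
      have "w \<in> insert x X" if "w \<in> closed_nbhd G v" for w
      proof (cases "w \<in> epn G S v")
        case False
        then have "w = v \<or> (\<exists>u\<in>S. u \<noteq> v \<and> w \<in> closed_nbhd G u)"
          using that closed_nbhd_self[of w G] unfolding epn_def by blast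
        then show ?thesis using other T(3) X(1) by blast
      qed (use x in auto)
      then have "closed_nbhd G v \<subseteq> X"
        using forcing_closedD[OF X(2), of v x] X(1) T(3) by auto
      then show "closed_nbhd_set G S \<subseteq> X" using other by (auto simp: closed_nbhd_set_def)
    qed (use S T in auto)
    \<comment> \<open>A neighbour of \<open>v\<close> in \<open>S\<close> would monitor
      \<open>v\<close>, so \<open>S - {v}\<close> would be a smaller power dominating set.\<close>
    have isol: "u = v" if "u \<in> S" "u \<in> closed_nbhd G v" for u
    proof (rule ccontr)
      assume "u \<noteq> v"
      then have "power_dominating G (S - {v})"
        using that SV by (intro transfer) (auto simp: closed_nbhd_set_def closed_nbhd_sym[of v])
      then have "card S \<le> card (S - {v})" using S power_domination_number_le by auto
      then show False using card_Diff1_less[OF fin v] by simp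
    qed
    \<comment> \<open>Here \<delta> \<ge> 2 enters: it yields a neighbour \<open>w\<close> of
      \<open>v\<close> that is not private. As \<open>v\<close> is isolated in G[S],
      \<open>w\<close> lies outside \<open>S\<close> and has another neighbour \<open>u\<close> in
      \<open>S\<close>.\<close>
    have "\<not> closed_nbhd G v \<subseteq> {v, x}"
    proof
      assume "closed_nbhd G v \<subseteq> {v, x}"
      then have "card (closed_nbhd G v) \<le> card {v, x}" by (intro card_mono) auto
      also have "\<dots> \<le> 2" by (simp add: card_insert_if)
      finally show False using min_degree_less_card_closed_nbhd[of v] v SV assms by auto
    qed
    then obtain w where w: "w \<in> closed_nbhd G v" "w \<noteq> v" "w \<notin> epn G S v" using x by auto
    then have "w \<notin> S" using isol by auto
    then obtain u where u: "u \<in> S" "u \<noteq> v" "w \<in> closed_nbhd G u" using w by (auto simp: epn_def)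
    \<comment> \<open>The vertex \<open>w\<close> monitors \<open>v\<close>, so power domination is
      kept. The exchange gains the non-isolated vertex \<open>w\<close>, adjacent to
      \<open>u\<close>, and loses none because \<open>v\<close> was isolated, against
      maximality.\<close>
    define T where "T = insert w (S - {v})"
    have "power_dominating G T"
      unfolding T_def using w v SV closed_nbhd_subset[of v] closed_nbhd_sym[of w v]
      by (intro transfer) (auto simp: closed_nbhd_set_def)
    moreover have "card T = card S"
      unfolding T_def using \<open>w \<notin> S\<close> card.remove[OF fin v] fin by simp
    ultimately have "card (non_isolated T) \<le> card (non_isolated S)" using S max by auto
    moreover have "insert w (non_isolated S) \<subseteq> non_isolated T"
    proof
      fix a assume "a \<in> insert w (non_isolated S)"
      then consider "a = w" | b where "a \<in> S" "b \<in> S" "b \<noteq> a" "b \<in> closed_nbhd G a"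
        by (auto simp: non_isolated_def)
      then show "a \<in> non_isolated T"
      proof cases
        case 1
        then show ?thesis
          using u \<open>w \<notin> S\<close> closed_nbhd_sym[of w u] by (auto simp: non_isolated_def T_def)
      next
        case 2
        then have "a \<noteq> v" "b \<noteq> v"
          using isol[of a] isol[of b] closed_nbhd_sym[of b a] by auto
        then show ?thesis using 2 by (auto simp: non_isolated_def T_def)
      qed
    qed
    then have "card (insert w (non_isolated S)) \<le> card (non_isolated T)"
      using fin by (intro card_mono) (auto simp: non_isolated_def T_def)
    moreover have "card (insert w (non_isolated S)) = Suc (card (non_isolated S))"
      using fin \<open>w \<notin> S\<close> by (subst card_insert_disjoint) (auto simp: non_isolated_def)
    ultimately show False by simp
  qed
  then show ?thesis using that S by blast
qed

section \<open>Lower bounds on the size of N[S]\<close>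

lemma card_closed_nbhd_set_ge:
  assumes "finite S" "v \<in> S"
  shows "card (closed_nbhd G v \<union> S) + (\<Sum>u\<in>S-{v}. card (epn G S u)) \<le> card (closed_nbhd_set G S)"
proof -
  have "card (\<Union>u\<in>S-{v}. epn G S u) = (\<Sum>u\<in>S-{v}. card (epn G S u))"
    using assms by (intro card_UN_disjoint) (auto simp: epn_def)
  \<comment> \<open>Private neighbours of vertices other than \<open>v\<close> lie neither in N[v]
    nor in \<open>S\<close>.\<close>
  moreover have "card ((closed_nbhd G v \<union> S) \<union> (\<Union>u\<in>S-{v}. epn G S u))
      = card (closed_nbhd G v \<union> S) + card (\<Union>u\<in>S-{v}. epn G S u)"
    using assms by (intro card_Un_disjoint) (auto simp: epn_def)
  moreover have "card ((closed_nbhd G v \<union> S) \<union> (\<Union>u\<in>S-{v}. epn G S u)) \<le> card (closed_nbhd_set G S)"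
    using assms epn_subset[of G S] subset_closed_nbhd_set[of S G]
    by (intro card_mono) (auto simp: closed_nbhd_set_def)
  ultimately show ?thesis by simp
qed

text \<open>Each vertex of \<open>S\<close> accounts for itself and two private neighbours, with no
  overlap.\<close>

lemma card_closed_nbhd_set_ge_triple:
  assumes "finite S" "\<And>v. v \<in> S \<Longrightarrow> card (epn G S v) \<ge> 2"
  shows "3 * card S \<le> card (closed_nbhd_set G S)"
proof -
  have "card S * 2 \<le> (\<Sum>u\<in>S. card (epn G S u))"
    using sum_bounded_below[of S 2 "\<lambda>u. card (epn G S u)"] assms(2) by simp
  also have "\<dots> = card (\<Union>u\<in>S. epn G S u)"
    using assms by (intro card_UN_disjoint[symmetric]) (auto simp: epn_def)
  finally have "3 * card S \<le> card S + card (\<Union>u\<in>S. epn G S u)" by simp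
  also have "\<dots> = card (S \<union> (\<Union>u\<in>S. epn G S u))"
    using assms by (intro card_Un_disjoint[symmetric]) (auto simp: epn_def)
  also have "\<dots> \<le> card (closed_nbhd_set G S)"
    using assms epn_subset[of G S] subset_closed_nbhd_set[of S G]
    by (intro card_mono) (auto simp: closed_nbhd_set_def)
  finally show ?thesis .
qed

text \<open>One chosen vertex contributes its closed neighbourhood, at least \<delta> + 1 vertices;
  each other vertex contributes two private neighbours.\<close>

lemma card_closed_nbhd_set_ge_min_degree:
  assumes "S \<subseteq> pverts G" "S \<noteq> {}" "\<And>v. v \<in> S \<Longrightarrow> card (epn G S v) \<ge> 2"
  shows "2 * card S + min_degree G \<le> card (closed_nbhd_set G S) + 1"
proof -
  have fin: "finite S" using assms(1) by (rule finite_subset) simp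
  obtain v where v: "v \<in> S" using assms(2) by auto
  have "card (S - {v}) * 2 \<le> (\<Sum>u\<in>S-{v}. card (epn G S u))"
    using sum_bounded_below[of "S - {v}" 2 "\<lambda>u. card (epn G S u)"] assms(3) by simp
  moreover have "card (closed_nbhd G v) \<le> card (closed_nbhd G v \<union> S)"
    using fin by (intro card_mono) auto
  moreover have "card S = Suc (card (S - {v}))" using fin v by (rule card.remove)
  moreover have "Suc (min_degree G) \<le> card (closed_nbhd G v)"
    using min_degree_less_card_closed_nbhd v assms(1) by auto
  ultimately show ?thesis using card_closed_nbhd_set_ge[OF fin v] by linarith
qed

text \<open>The last hypothesis leaves equality in \<open>card_closed_nbhd_set_ge_min_degree\<close>
  and so in every estimate of its proof; each conclusion reads off one of these equalities. Any
  vertex of \<open>S\<close> may serve as the base \<open>v\<close>.\<close>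

lemma closed_nbhd_set_tight:
  assumes "S \<subseteq> pverts G" "v \<in> S" "\<And>v. v \<in> S \<Longrightarrow> card (epn G S v) \<ge> 2"
    and "card (closed_nbhd_set G S) < 2 * card S + min_degree G"
  shows "S \<subseteq> closed_nbhd G v" "card (closed_nbhd G v) = Suc (min_degree G)"
    "\<And>u. u \<in> S \<Longrightarrow> u \<noteq> v \<Longrightarrow> card (epn G S u) = 2"
    "closed_nbhd_set G S \<subseteq> closed_nbhd G v \<union> (\<Union>u\<in>S-{v}. epn G S u)"
proof -
  have fin: "finite S" using assms(1) by (rule finite_subset) simp
  let ?s = "\<Sum>u\<in>S-{v}. card (epn G S u)"
  have lower: "card (S - {v}) * 2 \<le> ?s"
    using sum_bounded_below[of "S - {v}" 2 "\<lambda>u. card (epn G S u)"] assms(3) by simp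
  have mono: "card (closed_nbhd G v) \<le> card (closed_nbhd G v \<union> S)"
    using fin by (intro card_mono) auto
  have cS: "card S = Suc (card (S - {v}))" using fin assms(2) by (rule card.remove)
  have deg: "Suc (min_degree G) \<le> card (closed_nbhd G v)"
    using min_degree_less_card_closed_nbhd assms(1,2) by auto
  note ge = card_closed_nbhd_set_ge[OF fin assms(2)]
  show "card (closed_nbhd G v) = Suc (min_degree G)"
    using lower mono cS deg ge assms(4) by linarith
  have "card (closed_nbhd G v) = card (closed_nbhd G v \<union> S)"
    using lower mono cS deg ge assms(4) by linarith
  then have "closed_nbhd G v = closed_nbhd G v \<union> S"
    using fin by (intro card_subset_eq) auto
  then show clique: "S \<subseteq> closed_nbhd G v" by blast
  have s: "?s = card (S - {v}) * 2" using lower mono cS deg ge assms(4) by linarith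
  show "card (epn G S u) = 2" if "u \<in> S" "u \<noteq> v" for u
  proof (rule ccontr)
    assume "card (epn G S u) \<noteq> 2"
    then have "2 < card (epn G S u)" using assms(3)[OF that(1)] by simp
    then have "(\<Sum>u\<in>S-{v}. 2) < ?s"
      using that fin assms(3) by (intro sum_strict_mono_ex1) auto
    then show False using s by simp
  qed
  let ?U = "closed_nbhd G v \<union> (\<Union>u\<in>S-{v}. epn G S u)"
  have "card (\<Union>u\<in>S-{v}. epn G S u) = ?s"
    using fin by (intro card_UN_disjoint) (auto simp: epn_def)
  moreover have "card ?U = card (closed_nbhd G v) + card (\<Union>u\<in>S-{v}. epn G S u)"
    using fin assms(2) by (intro card_Un_disjoint) (auto simp: epn_def)
  ultimately have "card (closed_nbhd_set G S) \<le> card ?U"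
    using lower cS deg assms(4) by linarith
  moreover have "?U \<subseteq> closed_nbhd_set G S"
    using assms(2) epn_subset[of G S] by (auto simp: closed_nbhd_set_def)
  moreover have "finite (closed_nbhd_set G S)" using fin by (auto simp: closed_nbhd_set_def)
  ultimately have "?U = closed_nbhd_set G S" by (intro card_seteq) auto
  then show "closed_nbhd_set G S \<subseteq> ?U" by simp
qed

section \<open>Improving the equality case for \<gamma> \<ge> 3\<close>

lemma obtain_large_closed_nbhd_set:
  assumes "min_degree G \<ge> 2" "power_domination_number G \<ge> 3"
  obtains S where "power_dominating G S" "card S = power_domination_number G"
    "2 * card S + min_degree G \<le> card (closed_nbhd_set G S)"
proof -
  obtain S where S: "power_dominating G S" "card S = power_domination_number G"
    and two: "\<And>v. v \<in> S \<Longrightarrow> card (epn G S v) \<ge> 2"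
    using obtain_private_set[OF assms(1)] by metis
  have SV: "S \<subseteq> pverts G" and fin: "finite S"
    using S by (auto simp: power_dominating_def intro: finite_subset)
  \<comment> \<open>The exchanges below remove at most two vertices, so some vertex of
    \<open>S\<close> always stays.\<close>
  have third: "\<exists>t\<in>S. t \<noteq> u \<and> t \<noteq> v" for u v
  proof (rule ccontr)
    assume "\<not> ?thesis"
    then have "card S \<le> card {u, v}" by (intro card_mono) auto
    also have "\<dots> \<le> 2" by (simp add: card_insert_if)
    finally show False using S assms(2) by simp
  qed
  show ?thesis
  proof (cases "2 * card S + min_degree G \<le> card (closed_nbhd_set G S)")
    case True
    then show ?thesis using that S by blast
  next
    case False
    have clique: "a \<in> closed_nbhd G b" if "a \<in> S" "b \<in> S" for a b
      using closed_nbhd_set_tight(1)[OF SV that(2) two] False that by auto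
    \<comment> \<open>\<open>closed_nbhd_set_tight\<close> counts private neighbours only away from
      its base vertex, so a base different from \<open>a\<close> is chosen.\<close>
    have epn2: "card (epn G S a) = 2" if "a \<in> S" for a
      using closed_nbhd_set_tight(3)[OF SV _ two] False that third[of a a] by (metis not_le)
    have common: "y \<in> closed_nbhd G b \<or> y \<in> epn G S a"
      if "a \<in> S" "b \<in> S" "y \<in> closed_nbhd G a" for a b y
    proof -
      have "y \<in> closed_nbhd_set G S" using that by (auto simp: closed_nbhd_set_def)
      then have "y \<in> closed_nbhd G b \<or> (\<exists>u\<in>S. y \<in> epn G S u)"
        using closed_nbhd_set_tight(4)[OF SV that(2) two] False by auto
      then show ?thesis using that by (auto simp: epn_def)
    qed
    \<comment> \<open>Through \<open>t\<close>, all of N[a] except the private neighbours of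
      \<open>a\<close> lies in \<open>X\<close>. One of these two is given, so only the other can be
      missing, and \<open>a\<close> forces it.\<close>
    have fill: "closed_nbhd G a \<subseteq> X"
      if X: "forcing_closed G X" and a: "a \<in> S" "a' \<in> epn G S a" "a' \<in> X"
        and t: "t \<in> S" "closed_nbhd G t \<subseteq> X" for X a a' t
    proof -
      obtain a'' where "epn G S a = {a', a''}"
        using epn2[OF a(1)] a(2) by (auto simp: card_2_iff doubleton_eq_iff)
      then have "closed_nbhd G a \<subseteq> insert a'' X" using common[OF a(1) t(1)] t(2) a(3) by fastforce
      moreover have "a \<in> X" using clique[OF a(1) t(1)] t(2) by auto
      ultimately show ?thesis using forcing_closedD[OF X] by blast
    qed
    \<comment> \<open>Given such an edge, \<open>z\<close> could replace both \<open>u\<close> and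
      \<open>v\<close>: it is private to \<open>v\<close> and monitors \<open>y\<close>, which is
      private to \<open>u\<close>, so \<open>fill\<close> recovers both neighbourhoods. This
      contradicts the minimality of |S|.\<close>
    have no_edge: "\<not> z \<in> closed_nbhd G y"
      if uv: "u \<in> S" "v \<in> S" "u \<noteq> v" and y: "y \<in> epn G S u" and z: "z \<in> epn G S v" for u v y z
    proof
      assume yz: "z \<in> closed_nbhd G y"
      define T where "T = insert z (S - {u, v})"
      obtain t where t: "t \<in> S" "t \<noteq> u" "t \<noteq> v" using third by blast
      have "power_dominating G T"
      proof (rule power_dominating_transfer[OF S(1)])
        show "T \<subseteq> pverts G"
          using SV z epn_subset[of G S v] closed_nbhd_subset[of v] uv by (auto simp: T_def)
        fix X assume X: "closed_nbhd_set G T \<subseteq> X" "forcing_closed G X"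
        have other: "closed_nbhd G s \<subseteq> X" if "s \<in> T" for s
          using that X(1) closed_nbhd_subset_set[of s T G] by auto
        have "closed_nbhd G t \<subseteq> X" "z \<in> X" "y \<in> X"
          using other[of t] other[of z] t yz closed_nbhd_sym[of z y] closed_nbhd_self[of z G]
          by (auto simp: T_def)
        then have "closed_nbhd G u \<subseteq> X" "closed_nbhd G v \<subseteq> X"
          using fill[OF X(2)] t uv y z by blast+
        then have "closed_nbhd G s \<subseteq> X" if "s \<in> S" for s
          using that other by (auto simp: T_def)
        then show "closed_nbhd_set G S \<subseteq> X" by (auto simp: closed_nbhd_set_def)
      qed
      then have "card S \<le> card T" using S power_domination_number_le by simp
      also have "\<dots> \<le> Suc (card (S - {u, v}))" unfolding T_def using fin by (simp add: card_insert_if)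
      also have "card (S - {u, v}) = card S - 2" using uv fin by (subst card_Diff_subset) auto
      finally show False using S assms(2) by simp
    qed
    obtain u where u: "u \<in> S" using third by blast
    obtain y y' where y: "epn G S u = {y, y'}" "y \<noteq> y'" using epn2[OF u] by (auto simp: card_2_iff)
    obtain t where t: "t \<in> S" "t \<noteq> u" using third by blast
    have yu: "y \<in> closed_nbhd G u" "y \<notin> S" using y by (auto simp: epn_def)
    define T where "T = insert y (S - {u})"
    have "power_dominating G T"
    proof (rule power_dominating_transfer[OF S(1)])
      show "T \<subseteq> pverts G" using SV yu u closed_nbhd_subset[of u] by (auto simp: T_def)
      fix X assume X: "closed_nbhd_set G T \<subseteq> X" "forcing_closed G X"
      have other: "closed_nbhd G s \<subseteq> X" if "s \<in> T" for s
        using that X(1) closed_nbhd_subset_set[of s T G] by auto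
      have "closed_nbhd G t \<subseteq> X" "y \<in> X"
        using other[of t] other[of y] t closed_nbhd_self[of y G] by (auto simp: T_def)
      then have "closed_nbhd G u \<subseteq> X" using fill[OF X(2)] t u y by blast
      then have "closed_nbhd G s \<subseteq> X" if "s \<in> S" for s using that other by (auto simp: T_def)
      then show "closed_nbhd_set G S \<subseteq> X" by (auto simp: closed_nbhd_set_def)
    qed
    moreover have cT: "card T = card S"
      unfolding T_def using yu card.remove[OF fin u] fin by simp
    moreover have "2 * card S + min_degree G \<le> card (closed_nbhd_set G T)"
    proof -
      have finN: "finite (closed_nbhd_set G A)" if "finite A" for A
        using that by (auto simp: closed_nbhd_set_def)
      \<comment> \<open>Vertices of N[S] outside N[u] are private to other members of
        \<open>S\<close>, which \<open>no_edge\<close> excludes from N[y]; privacy of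
        \<open>y\<close> excludes \<open>S - {u}\<close>.\<close>
      have "closed_nbhd G y \<inter> closed_nbhd_set G S \<subseteq> closed_nbhd G u - (S - {u})"
      proof
        fix x assume x: "x \<in> closed_nbhd G y \<inter> closed_nbhd_set G S"
        then obtain s where s: "s \<in> S" "x \<in> closed_nbhd G s" by (auto simp: closed_nbhd_set_def)
        have "x \<notin> epn G S s" if "s \<noteq> u" using no_edge[OF u s(1)] that x y by auto
        then have "x \<in> closed_nbhd G u" using common[OF s(1) u s(2)] s by auto
        moreover have "x = u" if "x \<in> S"
          using that x y closed_nbhd_sym[of x y] by (auto simp: epn_def)
        ultimately show "x \<in> closed_nbhd G u - (S - {u})" by auto
      qed
      then have "card (closed_nbhd G y \<inter> closed_nbhd_set G S) \<le> card (closed_nbhd G u - (S - {u}))"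
        by (intro card_mono) auto
      also have "\<dots> = card (closed_nbhd G u) - card (S - {u})"
        using clique u fin by (intro card_Diff_subset) auto
      also have "\<dots> = Suc (min_degree G) - (card S - 1)"
        using closed_nbhd_set_tight(2)[OF SV u two] False fin u by auto
      finally have inter: "card (closed_nbhd G y \<inter> closed_nbhd_set G S)
        \<le> Suc (min_degree G) - (card S - 1)" .
      \<comment> \<open>This makes the truncated subtraction in \<open>inter\<close> a genuine
        one.\<close>
      have "card (S - {u}) \<le> card (closed_nbhd G u)"
        using clique u by (intro card_mono) auto
      then have "card S - 1 \<le> Suc (min_degree G)"
        using closed_nbhd_set_tight(2)[OF SV u two] False fin u by auto
      moreover have "Suc (min_degree G) \<le> card (closed_nbhd G y)"
        using min_degree_less_card_closed_nbhd closed_nbhd_subset[of u] u SV yu by auto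
      moreover have "card (closed_nbhd G y - closed_nbhd_set G S)
          = card (closed_nbhd G y) - card (closed_nbhd G y \<inter> closed_nbhd_set G S)"
        by (rule card_Diff_subset_Int) simp
      \<comment> \<open>Since N[y] has at least \<delta> + 1 vertices, at least \<gamma> - 1 \<ge> 2
        of them are new.\<close>
      ultimately have new: "2 \<le> card (closed_nbhd G y - closed_nbhd_set G S)"
        using inter S(2) assms(2) by linarith
      \<comment> \<open>Only \<open>y'\<close> can be lost: the rest of N[u] is \<open>y\<close> or
        lies in N[t]. Two gained against one lost supplies the missing vertex in the bound.\<close>
      have "x \<in> closed_nbhd_set G T" if x: "x \<in> closed_nbhd_set G S" "x \<noteq> y'" for x
      proof -
        obtain s where s: "s \<in> S" "x \<in> closed_nbhd G s"
          using x(1) by (auto simp: closed_nbhd_set_def)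
        show ?thesis
        proof (cases "s = u")
          case True
          then have "x \<in> closed_nbhd G t \<or> x = y" using common[OF u t(1)] s y x(2) by auto
          then show ?thesis using t by (auto simp: closed_nbhd_set_def T_def)
        qed (use s in \<open>auto simp: closed_nbhd_set_def T_def\<close>)
      qed
      then have "(closed_nbhd_set G S - {y'}) \<union> (closed_nbhd G y - closed_nbhd_set G S)
          \<subseteq> closed_nbhd_set G T"
        by (auto simp: closed_nbhd_set_def T_def)
      then have "card ((closed_nbhd_set G S - {y'}) \<union> (closed_nbhd G y - closed_nbhd_set G S))
          \<le> card (closed_nbhd_set G T)"
        using fin by (intro card_mono finN) (auto simp: T_def)
      moreover have "card ((closed_nbhd_set G S - {y'}) \<union> (closed_nbhd G y - closed_nbhd_set G S))
          = card (closed_nbhd_set G S - {y'}) + card (closed_nbhd G y - closed_nbhd_set G S)"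
        using finN[OF fin] by (intro card_Un_disjoint) auto
      moreover have "card (closed_nbhd_set G S) \<le> Suc (card (closed_nbhd_set G S - {y'}))"
        using finN[OF fin] by (auto simp: card_Diff_singleton_if)
      moreover have "2 * card S + min_degree G \<le> card (closed_nbhd_set G S) + 1"
        using u by (intro card_closed_nbhd_set_ge_min_degree SV two) auto
      ultimately show ?thesis using new by linarith
    qed
    ultimately show ?thesis using that[of T] S(2) by simp
  qed
qed

end

theorem theorem5p2:
  fixes G :: "'a pair_pre_digraph" and n \<delta> \<gamma> :: nat
  assumes "pair_graph G"
    and "Digraph_Component.connected (with_proj G)"
    and "n = card (pverts G)"
    and "\<delta> = min_degree G" and "\<delta> \<ge> 2"
    and "\<gamma> = power_domination_number G" and "\<gamma> \<ge> 2"
  shows "(\<gamma> = 2 \<and> \<delta> = 2 \<longrightarrow> int (propagation_radius G) \<le> int n - 5) \<and>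
         (\<gamma> = 2 \<and> \<delta> > 2 \<longrightarrow> int (propagation_radius G) \<le> int n - int \<delta> - 2) \<and>
         (\<gamma> > 2 \<longrightarrow> int (propagation_radius G)
            \<le> int n - int \<gamma> - max (2 * int \<gamma>) (int \<gamma> + int \<delta>) + 1)"
proof -
  interpret pair_graph G by fact
  obtain S where S: "power_dominating G S" "card S = \<gamma>"
    and two: "\<And>v. v \<in> S \<Longrightarrow> card (epn G S v) \<ge> 2"
    using obtain_private_set assms by metis
  have SV: "S \<subseteq> pverts G" and fin: "finite S" and ne: "S \<noteq> {}"
    using S assms(7) by (auto simp: power_dominating_def intro: finite_subset)
  note radius = propagation_radius_le[OF S(1)]
  have triple: "propagation_radius G + 3 * \<gamma> \<le> n + 1"
    using radius card_closed_nbhd_set_ge_triple[OF fin two] S(2) assms by linarith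
  have min_deg: "propagation_radius G + 2 * \<gamma> + \<delta> \<le> n + 2"
    using radius card_closed_nbhd_set_ge_min_degree[OF SV ne two] S(2) assms by linarith
  have large: "propagation_radius G + 2 * \<gamma> + \<delta> \<le> n + 1" if gt: "\<gamma> > 2"
  proof -
    obtain T where "power_dominating G T" "card T = \<gamma>"
      "2 * card T + min_degree G \<le> card (closed_nbhd_set G T)"
      by (rule obtain_large_closed_nbhd_set) (use gt assms in auto)
    then show ?thesis using propagation_radius_le[of T] assms by linarith
  qed
  \<comment> \<open>For \<gamma> = 2, \<open>triple\<close> gives n - 5 and \<open>min_deg\<close>
    gives n - \<delta> - 2; for \<gamma> > 2, \<open>triple\<close> and \<open>large\<close> match
    the two arguments of the maximum.\<close>
  show ?thesis using triple min_deg large by (auto simp: max_def)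
qed

end
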